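(* Let $M\in\mathbb{R}^{n\times n}$ be symmetric positive definite, $\delta\in(0,1)$, $\Omega=\{d\in\mathbb{R}^n: d\ge\delta e_n\}$, and let $\{t_k\}_{k\ge1}$ be positive stepsizes with $t_k\to0$ and $\sum_{k=1}^\infty t_k=\infty$. Let $\{d_k\}$ be generated by the projected subgradient algorithm described in the context. Let $$\kappa_*:=\min\{\kappa(d): d\in\Omega\},\qquad \kappa_*^k:=\min\{\kappa(d_j): j=1,\dots,k\}.$$ Then $$\liminf_{k\to\infty}\kappa(d_k)=\kappa_*\qquad\text{and}\qquad \kappa_*^k\downarrow\kappa_* .$$
   Context: $e_n$ is the all-ones vector, $\bullet$ the Hadamard (elementwise) product, $\operatorname{Diag}(d)$ the diagonal matrix with diagonal $d$. For $d\in\Omega$, the matrix $M\operatorname{Diag}(d)$ has real positive eigenvalues, and $\kappa(d):=\lambda_{\max}(M\operatorname{Diag}(d))/\lambda_{\min}(M\operatorname{Diag}(d))$; $\kappa(d):=\infty$ for $d\notin\Omega$. Projected subgradient algorithm. Input: $M$, $\{t_k\}$, $\delta$ as in the claim, a tolerance tol, and a (user-chosen, unspecified) rule for a stopping quantity stopcrit, initialized to $\infty$. Set $d_1=e_n$. For $k=1,2,\dots$, while stopcrit $>$ tol: compute eigenpairs $(\lambda_1^k,x_1^k)$ and $(\lambda_n^k,x_n^k)$ of $M\operatorname{Diag}(d_k)$ for its largest and smallest eigenvalue, respectively; set $$s_k=\frac{\lambda_1^k}{\lambda_n^k}\left(\frac{x_1^k\bullet x_1^k}{\langle x_1^k,d_k\bullet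 x_1^k\rangle}-\frac{x_n^k\bullet x_n^k}{\langle x_n^k,d_k\bullet x_n^k\rangle}\right),\qquad d_{k+1}=\max\left\{d_k-t_k\frac{s_k}{\|s_k\|},\ \delta e_n\right\},$$ where the max is componentwise (this is Euclidean projection onto $\Omega$) and $\|\cdot\|$ is the Euclidean norm; then update stopcrit. *)

theory Defs
  imports "HOL-Analysis.Analysis"
begin

text \<open>
  On \<^typ>\<open>real ^ 'n\<close> the library operations are componentwise: \<open>x * y\<close> is the Hadamard product,
  \<open>1\<close> is the all-ones vector, \<open>\<le>\<close> is the componentwise order and \<open>sup\<close> the componentwise maximum;
  \<open>norm\<close> is the Euclidean norm.
\<close>

definition symmetric_posdef :: "real ^ 'n ^ 'n \<Rightarrow> bool" where
  "symmetric_posdef M \<longleftrightarrow> transpose M = M \<and> (\<forall>x. x \<noteq> 0 \<longrightarrow> 0 < x \<bullet> (M *v x))"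

definition Diag :: "real ^ 'n \<Rightarrow> real ^ 'n ^ 'n" where
  "Diag d = (\<chi> i j. if i = j then d $ i else 0)"

definition eigenpair :: "real ^ 'n ^ 'n \<Rightarrow> real \<Rightarrow> real ^ 'n \<Rightarrow> bool" where
  "eigenpair A l x \<longleftrightarrow> x \<noteq> 0 \<and> A *v x = l *\<^sub>R x"

text \<open>
  Only real eigenvalues are collected. For the matrices of interest, \<open>M ** Diag d\<close> with \<open>M\<close>
  symmetric positive definite and \<open>d\<close> positive, all complex eigenvalues are real, so this is the
  whole spectrum.
\<close>

definition eigenvalues :: "real ^ 'n ^ 'n \<Rightarrow> real set" where
  "eigenvalues A = {l. \<exists>x. eigenpair A l x}"

definition lambda_max :: "real ^ 'n ^ 'n \<Rightarrow> real" where
  "lambda_max A = Max (eigenvalues A)"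

definition lambda_min :: "real ^ 'n ^ 'n \<Rightarrow> real" where
  "lambda_min A = Min (eigenvalues A)"

definition Omega :: "real \<Rightarrow> (real ^ 'n) set" where
  "Omega \<delta> = {d. \<delta> *\<^sub>R 1 \<le> d}"

definition kappa :: "real ^ 'n ^ 'n \<Rightarrow> real \<Rightarrow> real ^ 'n \<Rightarrow> ereal" where
  "kappa M \<delta> d =
     (if d \<in> Omega \<delta> then ereal (lambda_max (M ** Diag d) / lambda_min (M ** Diag d)) else \<infinity>)"

text \<open>
  The minimum of \<open>kappa\<close> over the infinite set \<open>Omega\<close> is written as an infimum; that it is attained
  is a separate claim (\<open>kappa_star M \<delta> \<in> kappa M \<delta> ` Omega \<delta>\<close>).
\<close>

definition kappa_star :: "real ^ 'n ^ 'n \<Rightarrow> real \<Rightarrow> ereal" where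
  "kappa_star M \<delta> = (INF d\<in>Omega \<delta>. kappa M \<delta> d)"

text \<open>Sequences are indexed from 1; the value at index 0 plays no role.\<close>

definition kappa_best :: "real ^ 'n ^ 'n \<Rightarrow> real \<Rightarrow> (nat \<Rightarrow> real ^ 'n) \<Rightarrow> nat \<Rightarrow> ereal" where
  "kappa_best M \<delta> d k = Min ((\<lambda>j. kappa M \<delta> (d j)) ` {1..k})"

definition subgrad :: "real ^ 'n \<Rightarrow> real \<Rightarrow> real ^ 'n \<Rightarrow> real \<Rightarrow> real ^ 'n \<Rightarrow> real ^ 'n" where
  "subgrad d lmax xmax lmin xmin =
     (lmax / lmin) *\<^sub>R ((1 / (xmax \<bullet> (d * xmax))) *\<^sub>R (xmax * xmax) - (1 / (xmin \<bullet> (d * xmin))) *\<^sub>R (xmin * xmin))"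

text \<open>
  One iteration of the loop body. The eigenvectors may be chosen arbitrarily in their eigenspaces.
  If \<open>s = 0\<close>, the convention \<open>1 / 0 = 0\<close> makes the step direction zero.
\<close>

definition psg_step ::
  "real ^ 'n ^ 'n \<Rightarrow> real \<Rightarrow> real \<Rightarrow> real ^ 'n \<Rightarrow> real ^ 'n \<Rightarrow> bool" where
  "psg_step M \<delta> t d d' \<longleftrightarrow>
     (\<exists>lmax xmax lmin xmin s.
        lmax = lambda_max (M ** Diag d) \<and> eigenpair (M ** Diag d) lmax xmax \<and>
        lmin = lambda_min (M ** Diag d) \<and> eigenpair (M ** Diag d) lmin xmin \<and>
        s = subgrad d lmax xmax lmin xmin \<and>
        d' = sup (d - t *\<^sub>R ((1 / norm s) *\<^sub>R s)) (\<delta> *\<^sub>R 1))"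

text \<open>
  A non-terminating run, producing an infinite sequence: \<open>stopcrit k\<close> is the value of the
  (unspecified) stopping quantity when the loop condition is tested before iteration \<open>k\<close>.
\<close>

definition psg_run ::
  "real ^ 'n ^ 'n \<Rightarrow> (nat \<Rightarrow> real) \<Rightarrow> real \<Rightarrow> real \<Rightarrow> (nat \<Rightarrow> ereal) \<Rightarrow> (nat \<Rightarrow> real ^ 'n) \<Rightarrow> bool" where
  "psg_run M t \<delta> tol stopcrit d \<longleftrightarrow>
     d 1 = 1 \<and> stopcrit 1 = \<infinity> \<and>
     (\<forall>k\<ge>1. stopcrit k > ereal tol \<and> psg_step M \<delta> (t k) (d k) (d (Suc k)))"

end

theory Submission
  imports Defs
begin

text \<open>
  The eigenvalue problem \<open>M Diag(d) x = l x\<close> is the symmetric pencil \<open>Diag(d) x = l M\<inverse> x\<close>, so its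
  extreme eigenvalues are the extreme values of \<open>\<langle>d, x \<bullet> x\<rangle> / \<langle>x, M\<inverse> x\<rangle>\<close>. Hence the largest is convex
  and the smallest concave in \<open>d\<close>, their ratio is quasiconvex, and the vector \<open>s\<close> of the algorithm
  satisfies \<open>\<langle>s, y - d\<rangle> < 0\<close> whenever \<open>\<kappa>(y) < \<kappa>(d)\<close>. If \<open>\<kappa>(d\<^sub>k)\<close> stayed above the values of
  \<open>\<kappa>\<close> on a ball of radius \<open>r\<close> around \<open>e\<close>, each step would decrease \<open>\<parallel>d\<^sub>k - e\<parallel>\<^sup>2\<close> by at least
  \<open>2 r t\<^sub>k - t\<^sub>k\<^sup>2\<close>, contradicting the divergence of the step sizes. The minimum over \<open>\<Omega>\<close> is attained
  because \<open>\<kappa>\<close> is invariant under scaling and bounds the ratios \<open>d\<^sub>i / d\<^sub>j\<close> up to a constant.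
\<close>

section \<open>Symmetric forms and the generalized Rayleigh quotient\<close>

lemma inner_matrix_vector_commute:
  fixes A :: "real ^ 'n ^ 'n"
  assumes "transpose A = A"
  shows "x \<bullet> (A *v y) = y \<bullet> (A *v x)"
  by (metis assms dot_lmul_matrix inner_commute transpose_matrix_vector)

text \<open>A zero of a nonnegative form is a minimum, so the derivative of the form vanishes there.
  The proof tests the direction \<open>Q *v x\<close>.\<close>

lemma psd_form_zero_imp_kernel:
  fixes Q :: "real ^ 'n ^ 'n"
  assumes sym: "transpose Q = Q" and psd: "\<And>x. 0 \<le> x \<bullet> (Q *v x)"
    and zero: "x \<bullet> (Q *v x) = 0"
  shows "Q *v x = 0"
proof -
  define y where "y = Q *v x"
  define c where "c = y \<bullet> (Q *v y)"
  \<comment> \<open>The change of the form along \<open>y\<close> is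
    \<open>2 * s * (y \<bullet> y) + s\<^sup>2 * c\<close>, minimal at
    \<open>- (y \<bullet> y) / c\<close>; the added 1 guards against \<open>c = 0\<close> and keeps
    the value negative unless \<open>y = 0\<close>.\<close>
  define s where "s = - (y \<bullet> y) / (c + 1)"
  have c: "0 \<le> c" using psd by (simp add: c_def)
  have "0 \<le> (x + s *\<^sub>R y) \<bullet> (Q *v (x + s *\<^sub>R y))" by (rule psd)
  also have "\<dots> = 2 * s * (y \<bullet> y) + s\<^sup>2 * c"
    using zero inner_matrix_vector_commute[OF sym, of x y]
    by (simp add: matrix_vector_right_distrib matrix_vector_mult_scaleR inner_add_left
        inner_add_right c_def power2_eq_square algebra_simps flip: y_def)
  also have "\<dots> = - (y \<bullet> y)\<^sup>2 * (c + 2) / (c + 1)\<^sup>2"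
    using c unfolding s_def by (simp add: divide_simps power2_eq_square) algebra
  finally have "(y \<bullet> y)\<^sup>2 * (c + 2) / (c + 1)\<^sup>2 \<le> 0" by simp
  then have "(y \<bullet> y)\<^sup>2 \<le> 0"
    using c by (simp add: divide_le_0_iff mult_le_0_iff)
  then show ?thesis by (simp add: y_def)
qed

lemma symmetric_posdefD:
  assumes "symmetric_posdef M"
  shows "transpose M = M" and "x \<noteq> 0 \<Longrightarrow> 0 < x \<bullet> (M *v x)"
  using assms by (auto simp: symmetric_posdef_def)

text \<open>The quotient of the two forms attains its maximum \<open>a\<close> on the unit sphere
  and is homogeneous of degree 0, so \<open>a\<close> bounds it everywhere. Hence the form of
  \<open>a *\<^sub>R W - A\<close> is nonnegative and vanishes at the maximizer, which therefore
  lies in its kernel.\<close>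

lemma generalized_rayleigh_max:
  fixes A W :: "real ^ 'n ^ 'n"
  assumes W: "symmetric_posdef W" and A: "transpose A = A"
  obtains a x where "x \<noteq> 0" "A *v x = a *\<^sub>R (W *v x)"
    "\<And>y. y \<bullet> (A *v y) \<le> a * (y \<bullet> (W *v y))"
proof -
  note pos = symmetric_posdefD(2)[OF W]
  define f where "f x = (x \<bullet> (A *v x)) / (x \<bullet> (W *v x))" for x
  let ?S = "sphere 0 1 :: (real ^ 'n) set"
  have "x \<bullet> (W *v x) \<noteq> 0" if "x \<in> ?S" for x
    using pos[of x] that by (cases "x = 0") auto
  then have "continuous_on ?S f"
    unfolding f_def by (intro continuous_intros matrix_vector_mult_linear_continuous_on) auto
  then obtain x where x: "x \<in> ?S" "\<And>y. y \<in> ?S \<Longrightarrow> f y \<le> f x"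
    using continuous_attains_sup[of ?S f] by auto
  from x(1) have x0: "x \<noteq> 0" by auto
  define a where "a = f x"
  have le: "y \<bullet> (A *v y) \<le> a * (y \<bullet> (W *v y))" for y
  proof (cases "y = 0")
    case False
    then have "f (y /\<^sub>R norm y) \<le> a"
      unfolding a_def by (intro x(2)) simp
    moreover have "f (y /\<^sub>R norm y) = f y"
      using False by (simp add: f_def matrix_vector_mult_scaleR)
    ultimately have "f y \<le> a" by simp
    then show ?thesis
      using pos[OF False] by (simp add: f_def pos_divide_le_eq)
  qed simp
  define Q where "Q = a *\<^sub>R W - A"
  have Qv: "Q *v y = a *\<^sub>R (W *v y) - A *v y" for y
    by (simp add: Q_def matrix_vector_mult_diff_rdistrib scaleR_matrix_vector_assoc)
  have "Q *v x = 0"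
  proof (rule psd_form_zero_imp_kernel)
    show "transpose Q = Q"
      using A symmetric_posdefD(1)[OF W]
      by (simp add: Q_def vec_eq_iff transpose_def)
    show "0 \<le> y \<bullet> (Q *v y)" for y
      using le[of y] by (simp add: Qv inner_diff_right)
    show "x \<bullet> (Q *v x) = 0"
      using pos[OF x0] by (simp add: Qv inner_diff_right a_def f_def)
  qed
  with that[OF x0 _ le] show thesis by (simp add: Qv)
qed

section \<open>The symmetric pencil of \<open>M ** Diag d\<close>\<close>

lemma Diag_mult_vec: "Diag d *v x = d * x"
  by (simp add: vec_eq_iff Diag_def matrix_vector_mult_def if_distrib[of "\<lambda>a. a * _"]
      cong: if_cong)

lemma transpose_Diag: "transpose (Diag d) = Diag d"
  by (simp add: vec_eq_iff transpose_def Diag_def)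

lemma inner_hadamard: "x \<bullet> (d * y) = d \<bullet> (x * y)" for x y d :: "real ^ 'n"
  by (simp add: inner_vec_def mult_ac)

lemma symmetric_posdef_inverse:
  fixes M :: "real ^ 'n ^ 'n"
  assumes "symmetric_posdef M"
  shows "M ** matrix_inv M = mat 1" "matrix_inv M ** M = mat 1"
    "symmetric_posdef (matrix_inv M)"
proof -
  have "\<forall>x. M *v x = 0 \<longrightarrow> x = 0"
    using symmetric_posdefD(2)[OF assms] by (metis inner_zero_right less_irrefl)
  then have "invertible M"
    by (simp add: invertible_left_inverse matrix_left_invertible_ker)
  then show MW: "M ** matrix_inv M = mat 1" and WM: "matrix_inv M ** M = mat 1"
    unfolding invertible_def matrix_inv_def by (metis (mono_tags, lifting) someI_ex)+
  let ?W = "matrix_inv M"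
  \<comment> \<open>Symmetry of the inverse: its transpose is also a left inverse of
    \<open>M\<close>, and a left inverse equals a right inverse.\<close>
  have "transpose ?W ** M = transpose (M ** ?W)"
    by (simp add: matrix_transpose_mul symmetric_posdefD(1)[OF assms])
  then have T: "transpose ?W ** M = mat 1" by (simp add: MW transpose_mat)
  have "transpose ?W = transpose ?W ** (M ** ?W)" by (simp add: MW)
  also have "\<dots> = ?W" by (simp add: matrix_mul_assoc T)
  finally have "transpose ?W = ?W" .
  moreover have "0 < x \<bullet> (?W *v x)" if "x \<noteq> 0" for x
  proof -
    define z where "z = ?W *v x"
    have x: "x = M *v z" by (simp add: z_def matrix_vector_mul_assoc MW)
    with that have "z \<noteq> 0" by auto
    from symmetric_posdefD(2)[OF assms this] show ?thesis
      by (simp add: inner_commute flip: x z_def)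
  qed
  ultimately show "symmetric_posdef ?W" by (simp add: symmetric_posdef_def)
qed

text \<open>Denominator of the Rayleigh quotient of the pencil. It is independent of
  \<open>d\<close>, while the numerator \<open>d \<bullet> (x * x)\<close> is linear in
  \<open>d\<close>.\<close>

definition inv_form :: "real ^ 'n ^ 'n \<Rightarrow> real ^ 'n \<Rightarrow> real" where
  "inv_form M x = x \<bullet> (matrix_inv M *v x)"

lemma inv_form_pos: "symmetric_posdef M \<Longrightarrow> x \<noteq> 0 \<Longrightarrow> 0 < inv_form M x"
  unfolding inv_form_def by (intro symmetric_posdefD symmetric_posdef_inverse)

lemma eigenpair_iff:
  fixes M :: "real ^ 'n ^ 'n"
  assumes "symmetric_posdef M"
  shows "eigenpair (M ** Diag d) l x \<longleftrightarrow> x \<noteq> 0 \<and> d * x = l *\<^sub>R (matrix_inv M *v x)"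
proof -
  let ?W = "matrix_inv M"
  have "M *v (d * x) = l *\<^sub>R x \<longleftrightarrow> d * x = l *\<^sub>R (?W *v x)"
  proof
    assume "M *v (d * x) = l *\<^sub>R x"
    then have "?W *v (M *v (d * x)) = ?W *v (l *\<^sub>R x)" by simp
    then show "d * x = l *\<^sub>R (?W *v x)"
      by (simp add: matrix_vector_mul_assoc symmetric_posdef_inverse[OF assms]
          matrix_vector_mult_scaleR)
  next
    assume "d * x = l *\<^sub>R (?W *v x)"
    then show "M *v (d * x) = l *\<^sub>R x"
      by (simp add: matrix_vector_mult_scaleR matrix_vector_mul_assoc
          symmetric_posdef_inverse[OF assms])
  qed
  then show ?thesis
    by (simp add: eigenpair_def Diag_mult_vec flip: matrix_vector_mul_assoc)
qed

text \<open>Pairing the pencil equation with \<open>x\<close> shows that an eigenvalue is the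
  Rayleigh quotient of its eigenvector.\<close>

lemma eigenpair_inv_form:
  assumes "symmetric_posdef M" "eigenpair (M ** Diag d) l x"
  shows "d \<bullet> (x * x) = l * inv_form M x"
proof -
  have "x \<bullet> (d * x) = x \<bullet> (l *\<^sub>R (matrix_inv M *v x))"
    using assms by (simp add: eigenpair_iff)
  then show ?thesis by (simp add: inner_hadamard inv_form_def)
qed

section \<open>Finiteness of the spectrum and its extreme values\<close>

lemma hadamard_square_pos:
  fixes d x :: "real ^ 'n"
  assumes "\<And>i. 0 < d $ i" "x \<noteq> 0"
  shows "0 < d \<bullet> (x * x)"
proof -
  from assms(2) obtain i where "x $ i \<noteq> 0" by (auto simp: vec_eq_iff)
  then have "0 < d $ i * (x $ i * x $ i)"
    using assms(1) by (simp add: zero_less_mult_iff not_less) linarith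
  then show ?thesis
    unfolding inner_vec_def using assms(1)
    by (intro sum_pos2[of UNIV i]) (auto simp: less_imp_le)
qed

text \<open>Makes \<open>Max\<close> and \<open>Min\<close> in \<open>lambda_max\<close> and
  \<open>lambda_min\<close> meaningful. One eigenvector per eigenvalue gives a pairwise orthogonal
  family, which is finite.\<close>

lemma finite_eigenvalues:
  fixes M :: "real ^ 'n ^ 'n"
  assumes M: "symmetric_posdef M" and d: "\<And>i. 0 < d $ i"
  shows "finite (eigenvalues (M ** Diag d))"
proof -
  let ?W = "matrix_inv M" and ?E = "eigenvalues (M ** Diag d)"
  have "\<forall>l\<in>?E. \<exists>x. eigenpair (M ** Diag d) l x" by (simp add: eigenvalues_def)
  then obtain v where v: "\<And>l. l \<in> ?E \<Longrightarrow> eigenpair (M ** Diag d) l (v l)" by metis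
  \<comment> \<open>After this rescaling, eigenvectors of distinct eigenvalues are Euclidean-orthogonal.\<close>
  define z where "z l = (\<chi> i. sqrt (d $ i)) * v l" for l
  have z: "z l \<bullet> z m = d \<bullet> (v l * v m)" for l m
  proof -
    have "z l $ i * z m $ i = d $ i * (v l $ i * v m $ i)" for i
      using d[of i] by (simp add: z_def)
    then show ?thesis by (simp add: inner_vec_def)
  qed
  have z0: "z l \<bullet> z m = 0" if "l \<in> ?E" "m \<in> ?E" "l \<noteq> m" for l m
  proof -
    have "d * v l = l *\<^sub>R (?W *v v l)" "d * v m = m *\<^sub>R (?W *v v m)"
      using v that by (auto simp: eigenpair_iff[OF M])
    \<comment> \<open>The same product is \<open>l\<close> times and \<open>m\<close> times a common
      number, by symmetry of the inverse, so it vanishes when \<open>l\<close> and \<open>m\<close>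
      differ.\<close>
    then have lm: "z l \<bullet> z m = l * (v m \<bullet> (?W *v v l))" "z l \<bullet> z m = m * (v l \<bullet> (?W *v v m))"
      by (metis z inner_hadamard inner_scaleR_right mult.commute)+
    have "v m \<bullet> (?W *v v l) = v l \<bullet> (?W *v v m)"
      by (intro inner_matrix_vector_commute symmetric_posdefD symmetric_posdef_inverse M)
    with lm that(3) show ?thesis by auto
  qed
  have zpos: "0 < z l \<bullet> z l" if "l \<in> ?E" for l
    unfolding z using v[OF that] by (intro hadamard_square_pos d) (simp add: eigenpair_def)
  \<comment> \<open>A common image of two distinct eigenvalues would be a nonzero vector orthogonal
    to itself.\<close>
  have "inj_on z ?E"
    using z0 zpos by (intro inj_onI) (metis less_irrefl)
  moreover have "finite (z ` ?E)"
    using z0 by (intro pairwise_orthogonal_imp_finite) (auto simp: pairwise_def orthogonal_def)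
  ultimately show ?thesis by (rule finite_imageD[rotated])
qed

text \<open>The Rayleigh maximum for \<open>Diag d\<close> gives the upper bound; the one for
  \<open>Diag (-d)\<close>, with its sign reversed, gives the lower bound.\<close>

lemma eigenvalue_bounds_attained:
  fixes M :: "real ^ 'n ^ 'n"
  assumes M: "symmetric_posdef M"
  obtains a b where "a \<in> eigenvalues (M ** Diag d)" "b \<in> eigenvalues (M ** Diag d)"
    "\<And>x. d \<bullet> (x * x) \<le> a * inv_form M x" "\<And>x. b * inv_form M x \<le> d \<bullet> (x * x)"
proof -
  note W = symmetric_posdef_inverse(3)[OF M]
  obtain a x where a: "x \<noteq> 0" "Diag d *v x = a *\<^sub>R (matrix_inv M *v x)"
    "\<And>y. y \<bullet> (Diag d *v y) \<le> a * (y \<bullet> (matrix_inv M *v y))"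
    using generalized_rayleigh_max[OF W transpose_Diag] by metis
  obtain b z where b: "z \<noteq> 0" "Diag (-d) *v z = b *\<^sub>R (matrix_inv M *v z)"
    "\<And>y. y \<bullet> (Diag (-d) *v y) \<le> b * (y \<bullet> (matrix_inv M *v y))"
    using generalized_rayleigh_max[OF W transpose_Diag] by metis
  show thesis
  proof
    show "a \<in> eigenvalues (M ** Diag d)"
      using a by (auto simp: eigenvalues_def eigenpair_iff[OF M] Diag_mult_vec)
    have "d * z = (- b) *\<^sub>R (matrix_inv M *v z)"
      using b(2) by (simp add: Diag_mult_vec) (metis minus_minus)
    then show "- b \<in> eigenvalues (M ** Diag d)"
      using b(1) by (auto simp: eigenvalues_def eigenpair_iff[OF M])
    show "d \<bullet> (x * x) \<le> a * inv_form M x" for x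
      using a(3)[of x] by (simp add: Diag_mult_vec inner_hadamard inv_form_def)
    show "- b * inv_form M x \<le> d \<bullet> (x * x)" for x
      using b(3)[of x] by (simp add: Diag_mult_vec inner_hadamard inv_form_def)
  qed
qed

text \<open>The two eigenvalues that bound the quotient lie between \<open>Min\<close> and
  \<open>Max\<close> of the spectrum, so the bounds pass to the extreme eigenvalues. Positivity
  holds because each eigenvalue is a quotient of two positive forms.\<close>

lemma lambda_extremal:
  fixes M :: "real ^ 'n ^ 'n"
  assumes M: "symmetric_posdef M" and d: "\<And>i. 0 < d $ i"
  shows "\<exists>x. eigenpair (M ** Diag d) (lambda_max (M ** Diag d)) x"
    and "\<exists>x. eigenpair (M ** Diag d) (lambda_min (M ** Diag d)) x"
    and "d \<bullet> (x * x) \<le> lambda_max (M ** Diag d) * inv_form M x"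
    and "lambda_min (M ** Diag d) * inv_form M x \<le> d \<bullet> (x * x)"
    and "0 < lambda_min (M ** Diag d)"
    and "0 < lambda_max (M ** Diag d)"
proof -
  let ?E = "eigenvalues (M ** Diag d)"
  obtain a b where ab: "a \<in> ?E" "b \<in> ?E"
    "\<And>x. d \<bullet> (x * x) \<le> a * inv_form M x" "\<And>x. b * inv_form M x \<le> d \<bullet> (x * x)"
    using eigenvalue_bounds_attained[OF M] by metis
  have fin: "finite ?E" by (rule finite_eigenvalues[OF M d])
  have mx: "lambda_max (M ** Diag d) \<in> ?E" and mn: "lambda_min (M ** Diag d) \<in> ?E"
    unfolding lambda_max_def lambda_min_def using fin ab(1) by (auto intro: Max_in Min_in)
  then show "\<exists>x. eigenpair (M ** Diag d) (lambda_max (M ** Diag d)) x"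
    and "\<exists>x. eigenpair (M ** Diag d) (lambda_min (M ** Diag d)) x"
    by (auto simp: eigenvalues_def)
  have pos: "0 < l" if "l \<in> ?E" for l
  proof -
    from that obtain v where v: "eigenpair (M ** Diag d) l v" by (auto simp: eigenvalues_def)
    then have "v \<noteq> 0" by (simp add: eigenpair_def)
    with hadamard_square_pos[OF d, of v] inv_form_pos[OF M, of v] show ?thesis
      by (simp add: eigenpair_inv_form[OF M v] zero_less_mult_iff)
  qed
  show "0 < lambda_min (M ** Diag d)" "0 < lambda_max (M ** Diag d)" using mx mn pos by auto
  have B: "0 \<le> inv_form M x" using inv_form_pos[OF M, of x] by (cases "x = 0") (auto simp: inv_form_def)
  have "a \<le> lambda_max (M ** Diag d)" "lambda_min (M ** Diag d) \<le> b"
    unfolding lambda_max_def lambda_min_def using fin ab by auto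
  with ab(3,4)[of x] B show "d \<bullet> (x * x) \<le> lambda_max (M ** Diag d) * inv_form M x"
    and "lambda_min (M ** Diag d) * inv_form M x \<le> d \<bullet> (x * x)"
    by (meson mult_right_mono order_trans)+
qed


text \<open>
  Unlike \<open>kappa\<close>, this is not truncated outside \<open>Omega\<close>: the ball around a point of \<open>Omega\<close> in the
  descent argument may leave \<open>Omega\<close> while staying in the positive orthant.
\<close>

definition cond_ratio :: "real ^ 'n ^ 'n \<Rightarrow> real ^ 'n \<Rightarrow> real" where
  "cond_ratio M d = lambda_max (M ** Diag d) / lambda_min (M ** Diag d)"

section \<open>Continuity of the condition number on the positive orthant\<close>

lemma hadamard_square_bound:
  fixes w x :: "real ^ 'n"
  shows "\<bar>w \<bullet> (x * x)\<bar> \<le> norm w * (1 \<bullet> (x * x))"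
proof -
  have "\<bar>w \<bullet> (x * x)\<bar> \<le> (\<Sum>i\<in>UNIV. \<bar>w $ i * (x $ i * x $ i)\<bar>)"
    unfolding inner_vec_def by (simp add: sum_abs)
  also have "\<dots> \<le> (\<Sum>i\<in>UNIV. norm w * (x $ i * x $ i))"
    by (intro sum_mono) (simp add: abs_mult mult_right_mono component_le_norm_cart)
  finally show ?thesis by (simp add: inner_vec_def sum_distrib_left)
qed

text \<open>An extreme eigenvector for \<open>y\<close> is used as a trial vector for
  \<open>z\<close>. Replacing \<open>z\<close> by \<open>y\<close> changes the quotient by at most
  \<open>norm (y - z)\<close> times the largest eigenvalue of \<open>M\<close>, since
  \<open>Diag 1\<close> is the identity.\<close>

lemma lambda_perturbation:
  fixes M :: "real ^ 'n ^ 'n"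
  assumes M: "symmetric_posdef M" and y: "\<And>i. 0 < y $ i" and z: "\<And>i. 0 < z $ i"
  shows "lambda_max (M ** Diag y) \<le> lambda_max (M ** Diag z) + lambda_max (M ** Diag 1) * norm (y - z)"
    and "lambda_min (M ** Diag z) \<le> lambda_min (M ** Diag y) + lambda_max (M ** Diag 1) * norm (y - z)"
proof -
  let ?C = "lambda_max (M ** Diag 1)"
  have bound: "\<bar>(y - z) \<bullet> (x * x)\<bar> \<le> ?C * norm (y - z) * inv_form M x" for x
  proof -
    have "1 \<bullet> (x * x) \<le> ?C * inv_form M x" by (intro lambda_extremal(3) M) simp
    from mult_left_mono[OF this norm_ge_zero[of "y - z"]] hadamard_square_bound[of "y - z" x]
    show ?thesis by (simp add: mult_ac)
  qed
  obtain u where u: "eigenpair (M ** Diag y) (lambda_max (M ** Diag y)) u"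
    using lambda_extremal(1)[OF M y] by blast
  then have "0 < inv_form M u" by (intro inv_form_pos M) (simp add: eigenpair_def)
  moreover have "lambda_max (M ** Diag y) * inv_form M u
      \<le> (lambda_max (M ** Diag z) + ?C * norm (y - z)) * inv_form M u"
    using bound[of u] lambda_extremal(3)[OF M z, of u] eigenpair_inv_form[OF M u]
    by (simp add: inner_diff_left distrib_right)
  ultimately show "lambda_max (M ** Diag y) \<le> lambda_max (M ** Diag z) + ?C * norm (y - z)"
    by simp
  obtain v where v: "eigenpair (M ** Diag y) (lambda_min (M ** Diag y)) v"
    using lambda_extremal(2)[OF M y] by blast
  then have "0 < inv_form M v" by (intro inv_form_pos M) (simp add: eigenpair_def)
  moreover have "lambda_min (M ** Diag z) * inv_form M v
      \<le> (lambda_min (M ** Diag y) + ?C * norm (y - z)) * inv_form M v"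
    using bound[of v] lambda_extremal(4)[OF M z, of v] eigenpair_inv_form[OF M v]
    by (simp add: inner_diff_left distrib_right)
  ultimately show "lambda_min (M ** Diag z) \<le> lambda_min (M ** Diag y) + ?C * norm (y - z)"
    by simp
qed

lemma continuous_on_cond_ratio:
  fixes M :: "real ^ 'n ^ 'n"
  assumes M: "symmetric_posdef M"
  shows "continuous_on {d. \<forall>i. 0 < d $ i} (cond_ratio M)"
proof -
  let ?P = "{d :: real ^ 'n. \<forall>i. 0 < d $ i}" and ?C = "lambda_max (M ** Diag 1)"
  have C: "0 \<le> ?C" using lambda_extremal(6)[OF M, of 1] by simp
  have "?C-lipschitz_on ?P (\<lambda>d. lambda_max (M ** Diag d))"
    "?C-lipschitz_on ?P (\<lambda>d. lambda_min (M ** Diag d))"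
  proof -
    have "\<bar>lambda_max (M ** Diag x) - lambda_max (M ** Diag y)\<bar> \<le> ?C * norm (x - y)"
      "\<bar>lambda_min (M ** Diag x) - lambda_min (M ** Diag y)\<bar> \<le> ?C * norm (x - y)"
      if "x \<in> ?P" "y \<in> ?P" for x y
      using lambda_perturbation[OF M, of x y] lambda_perturbation[OF M, of y x] that
      by (auto simp: norm_minus_commute)
    then show "?C-lipschitz_on ?P (\<lambda>d. lambda_max (M ** Diag d))"
      "?C-lipschitz_on ?P (\<lambda>d. lambda_min (M ** Diag d))"
      using C by (auto intro!: lipschitz_onI simp: dist_norm)
  qed
  then show ?thesis
    unfolding cond_ratio_def using lambda_extremal(5)[OF M]
    by (intro continuous_on_divide lipschitz_on_continuous_on) (auto simp: less_le)
qed

section \<open>Scaling and existence of a minimizer\<close>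

lemma cond_ratio_scaleR_le:
  fixes M :: "real ^ 'n ^ 'n"
  assumes M: "symmetric_posdef M" and d: "\<And>i. 0 < d $ i" and c: "0 < c"
  shows "cond_ratio M (c *\<^sub>R d) \<le> cond_ratio M d"
proof -
  have cd: "\<And>i. 0 < (c *\<^sub>R d) $ i" using c d by simp
  obtain u where u: "eigenpair (M ** Diag (c *\<^sub>R d)) (lambda_max (M ** Diag (c *\<^sub>R d))) u"
    using lambda_extremal(1)[OF M cd] by blast
  then have "0 < inv_form M u" by (intro inv_form_pos M) (simp add: eigenpair_def)
  moreover have "lambda_max (M ** Diag (c *\<^sub>R d)) * inv_form M u
      \<le> (c * lambda_max (M ** Diag d)) * inv_form M u"
    using mult_left_mono[OF lambda_extremal(3)[OF M d, of u] less_imp_le[OF c]]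
      eigenpair_inv_form[OF M u] by simp
  ultimately have 1: "lambda_max (M ** Diag (c *\<^sub>R d)) \<le> c * lambda_max (M ** Diag d)" by simp
  obtain v where v: "eigenpair (M ** Diag (c *\<^sub>R d)) (lambda_min (M ** Diag (c *\<^sub>R d))) v"
    using lambda_extremal(2)[OF M cd] by blast
  then have "0 < inv_form M v" by (intro inv_form_pos M) (simp add: eigenpair_def)
  moreover have "(c * lambda_min (M ** Diag d)) * inv_form M v
      \<le> lambda_min (M ** Diag (c *\<^sub>R d)) * inv_form M v"
    using mult_left_mono[OF lambda_extremal(4)[OF M d, of v] less_imp_le[OF c]]
      eigenpair_inv_form[OF M v] by simp
  ultimately have 2: "c * lambda_min (M ** Diag d) \<le> lambda_min (M ** Diag (c *\<^sub>R d))" by simp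
  have "cond_ratio M (c *\<^sub>R d) \<le> (c * lambda_max (M ** Diag d)) / (c * lambda_min (M ** Diag d))"
    unfolding cond_ratio_def
    using 1 2 c lambda_extremal(5,6)[OF M d] lambda_extremal(5,6)[OF M cd]
    by (intro frac_le) auto
  with c show ?thesis by (simp add: cond_ratio_def)
qed

text \<open>Testing the extremal bounds on coordinate vectors bounds \<open>d $ i\<close> above by
  \<open>lambda_max\<close> and \<open>d $ j\<close> below by \<open>lambda_min\<close>, up to
  factors depending on \<open>M\<close> alone; dividing brings in the condition number.\<close>

lemma entries_le_cond_ratio:
  fixes M :: "real ^ 'n ^ 'n"
  assumes M: "symmetric_posdef M"
  obtains K where "0 < K"
    "\<And>d i j. (\<And>i. 0 < d $ i) \<Longrightarrow> d $ i \<le> K * cond_ratio M d * d $ j"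
proof -
  define B where "B i = inv_form M (axis i 1)" for i :: 'n
  have B: "0 < B i" for i unfolding B_def by (intro inv_form_pos M) (simp add: axis_eq_0_iff)
  \<comment> \<open>The product of the two sums dominates every quotient \<open>B i / B j\<close> at
    once.\<close>
  define K where "K = (\<Sum>i\<in>UNIV. B i) * (\<Sum>j\<in>UNIV. 1 / B j)"
  have K: "B i / B j \<le> K" for i j
  proof -
    have "B i \<le> (\<Sum>i\<in>UNIV. B i)" "1 / B j \<le> (\<Sum>j\<in>UNIV. 1 / B j)"
      using B by (auto intro!: member_le_sum simp: less_imp_le)
    then have "B i * (1 / B j) \<le> K"
      unfolding K_def using B by (intro mult_mono) (auto simp: less_imp_le intro: sum_nonneg)
    then show ?thesis by simp
  qed
  show thesis
  proof
    have "0 < B undefined / B undefined" using B[of undefined] by simp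
    with K[of undefined undefined] show "0 < K" by linarith
  next
    fix d :: "real ^ 'n" and i j
    assume d: "\<And>i. 0 < d $ i"
    have ax: "d \<bullet> (axis i 1 * axis i 1) = d $ i" for i
    proof -
      have "axis i 1 * axis i 1 = (axis i 1 :: real ^ 'n)" by (simp add: vec_eq_iff axis_def)
      then show ?thesis by (simp add: inner_axis)
    qed
    let ?a = "lambda_max (M ** Diag d)" and ?b = "lambda_min (M ** Diag d)"
    note ab = lambda_extremal(5,6)[OF M d]
    have "d $ i \<le> ?a * B i" "?b * B j \<le> d $ j"
      using lambda_extremal(3)[OF M d, of "axis i 1"] lambda_extremal(4)[OF M d, of "axis j 1"]
      by (auto simp: ax B_def)
    have "d $ i \<le> ?a * B i" by fact
    also have "\<dots> = (B i / B j) * cond_ratio M d * (?b * B j)"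
      using ab B[of j] by (simp add: cond_ratio_def)
    also have "\<dots> \<le> K * cond_ratio M d * d $ j"
      using \<open>?b * B j \<le> d $ j\<close> K[of i j] ab B[of i] B[of j] d[of j]
      by (intro mult_mono mult_nonneg_nonneg) (auto simp: cond_ratio_def less_imp_le
          intro: order_trans[rotated])
    finally show "d $ i \<le> K * cond_ratio M d * d $ j" .
  qed
qed

lemma mem_Omega: "d \<in> Omega \<delta> \<longleftrightarrow> (\<forall>i. \<delta> \<le> d $ i)"
  by (simp add: Omega_def less_eq_vec_def)

text \<open>\<open>Omega\<close> is unbounded, so compactness is applied to a box. Any competitor is
  rescaled until its smallest entry is \<delta>; the bound on the ratios of its entries then places
  it in the box.\<close>

lemma cond_ratio_attains_min:
  fixes M :: "real ^ 'n ^ 'n"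
  assumes M: "symmetric_posdef M" and \<delta>: "0 < \<delta>" "\<delta> < 1"
  obtains e where "e \<in> Omega \<delta>" "\<And>d. d \<in> Omega \<delta> \<Longrightarrow> cond_ratio M e \<le> cond_ratio M d"
proof -
  obtain K where K: "0 < K"
    "\<And>d i j. (\<And>i. 0 < d $ i) \<Longrightarrow> d $ i \<le> K * cond_ratio M d * d $ j"
    using entries_le_cond_ratio[OF M] by metis
  \<comment> \<open>Bounds the entries of a vector with smallest entry \<delta> that is no worse
    than the all-ones vector; the maximum with 1 keeps the all-ones vector itself in the
    box.\<close>
  define R where "R = max 1 (K * cond_ratio M 1 * \<delta>)"
  let ?S = "cbox (\<delta> *\<^sub>R 1) (R *\<^sub>R 1) :: (real ^ 'n) set"
  have S: "d \<in> ?S \<longleftrightarrow> (\<forall>i. \<delta> \<le> d $ i \<and> d $ i \<le> R)" for d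
    by (simp add: mem_box_cart)
  have one: "1 \<in> ?S" unfolding S using \<delta> by (simp add: R_def)
  have "continuous_on ?S (cond_ratio M)"
    using \<delta> by (intro continuous_on_subset[OF continuous_on_cond_ratio[OF M]])
      (auto simp: S intro: less_le_trans)
  then obtain e where e: "e \<in> ?S" "\<And>d. d \<in> ?S \<Longrightarrow> cond_ratio M e \<le> cond_ratio M d"
    using continuous_attains_inf[of ?S "cond_ratio M"] one by (auto simp: compact_cbox)
  show thesis
  proof
    show "e \<in> Omega \<delta>" using e(1) by (simp add: S mem_Omega)
  next
    fix d :: "real ^ 'n" assume "d \<in> Omega \<delta>"
    then have d: "\<delta> \<le> d $ i" "0 < d $ i" for i
      using \<delta> by (auto simp: mem_Omega intro: less_le_trans)
    show "cond_ratio M e \<le> cond_ratio M d"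
    proof (cases "cond_ratio M d \<le> cond_ratio M 1")
      case False
      then show ?thesis using e(2)[OF one] by linarith
    next
      case True
      have "Min (range (($) d)) \<in> range (($) d)" by (intro Min_in) auto
      then obtain j where "Min (range (($) d)) = d $ j" by blast
      then have j: "d $ j \<le> d $ i" for i
        using Min_le[of "range (($) d)" "d $ i"] by simp
      define c where "c = \<delta> / d $ j"
      have c: "0 < c" "(c *\<^sub>R d) $ j = \<delta>" using d[of j] \<delta> by (auto simp: c_def)
      then have cd: "0 < (c *\<^sub>R d) $ i" for i using d[of i] by simp
      have le: "cond_ratio M (c *\<^sub>R d) \<le> cond_ratio M d"
        by (intro cond_ratio_scaleR_le M c d)
      have "\<delta> \<le> (c *\<^sub>R d) $ i" for i
      proof -
        have "c * d $ j \<le> c * d $ i" using j c(1) by (intro mult_left_mono) auto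
        with c(2) show ?thesis by simp
      qed
      moreover have "(c *\<^sub>R d) $ i \<le> R" for i
      proof -
        have "(c *\<^sub>R d) $ i \<le> K * cond_ratio M (c *\<^sub>R d) * (c *\<^sub>R d) $ j"
          using K(2)[of "c *\<^sub>R d" i j] cd by blast
        also have "\<dots> = K * cond_ratio M (c *\<^sub>R d) * \<delta>" by (simp only: c(2))
        also have "\<dots> \<le> K * cond_ratio M 1 * \<delta>"
          using le True K(1) \<delta> by (intro mult_right_mono mult_left_mono) auto
        finally show ?thesis by (simp add: R_def)
      qed
      ultimately have "c *\<^sub>R d \<in> ?S" by (simp add: S)
      from e(2)[OF this] le show ?thesis by linarith
    qed
  qed
qed

section \<open>Descent towards better points in a single step\<close>

text \<open>Up to the positive factor \<open>cond_ratio M d\<close>, the inner product is the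
  difference of the Rayleigh quotients of \<open>y\<close> at \<open>u\<close> and at
  \<open>v\<close>, each divided by the corresponding eigenvalue for \<open>d\<close>. The first is
  at most \<open>lambda_max\<close> for \<open>y\<close>, the second at least
  \<open>lambda_min\<close> for \<open>y\<close>.\<close>

lemma subgrad_descent:
  fixes M :: "real ^ 'n ^ 'n"
  assumes M: "symmetric_posdef M" and d: "\<And>i. 0 < d $ i" and y: "\<And>i. 0 < y $ i"
    and u: "eigenpair (M ** Diag d) (lambda_max (M ** Diag d)) u"
    and v: "eigenpair (M ** Diag d) (lambda_min (M ** Diag d)) v"
    and less: "cond_ratio M y < cond_ratio M d"
  shows "subgrad d (lambda_max (M ** Diag d)) u (lambda_min (M ** Diag d)) v \<bullet> (y - d) < 0"
proof -
  let ?a = "lambda_max (M ** Diag d)" and ?b = "lambda_min (M ** Diag d)"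
  note ab = lambda_extremal(5,6)[OF M d] and aby = lambda_extremal(5,6)[OF M y]
  have B: "0 < inv_form M u" "0 < inv_form M v"
    using u v by (auto intro!: inv_form_pos M simp: eigenpair_def)
  have du: "u \<bullet> (d * u) = ?a * inv_form M u" and dv: "v \<bullet> (d * v) = ?b * inv_form M v"
    using eigenpair_inv_form[OF M u] eigenpair_inv_form[OF M v] by (simp_all add: inner_hadamard)
  have "(u * u) \<bullet> y / (?a * inv_form M u) \<le> lambda_max (M ** Diag y) / ?a"
    using lambda_extremal(3)[OF M y, of u] ab B by (simp add: inner_commute field_simps)
  \<comment> \<open>The inequality \<open>cond_ratio M y < cond_ratio M d\<close>,
    rearranged.\<close>
  also have "\<dots> < lambda_min (M ** Diag y) / ?b"
    using less ab aby by (simp add: cond_ratio_def field_simps)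
  also have "\<dots> \<le> (v * v) \<bullet> y / (?b * inv_form M v)"
    using lambda_extremal(4)[OF M y, of v] ab B by (simp add: inner_commute field_simps)
  finally have lt: "(u * u) \<bullet> y / (?a * inv_form M u) - (v * v) \<bullet> y / (?b * inv_form M v) < 0"
    by simp
  have eq: "(u * u) \<bullet> d = ?a * inv_form M u" "(v * v) \<bullet> d = ?b * inv_form M v"
    using eigenpair_inv_form[OF M u] eigenpair_inv_form[OF M v] by (simp_all add: inner_commute)
  \<comment> \<open>The contributions of \<open>d\<close> to the two normalized quotients both equal
    1 and cancel.\<close>
  have "subgrad d ?a u ?b v \<bullet> (y - d) =
      ?a / ?b * ((u * u) \<bullet> y / (?a * inv_form M u) - (v * v) \<bullet> y / (?b * inv_form M v))"
    using ab B unfolding subgrad_def du dv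
    by (simp add: inner_diff_left inner_diff_right eq)
  also have "\<dots> < 0" using lt ab by (intro mult_pos_neg) auto
  finally show ?thesis .
qed

text \<open>Clipping at \<delta> moves a component, if at all, towards \<open>e $ i\<close>, which
  is at least \<delta>.\<close>

lemma norm_sup_diff_le:
  fixes p e :: "real ^ 'n"
  assumes "e \<in> Omega \<delta>"
  shows "norm (sup p (\<delta> *\<^sub>R 1) - e) \<le> norm (p - e)"
proof (rule norm_le_componentwise_cart)
  fix i
  have "\<delta> \<le> e $ i" using assms by (simp add: mem_Omega)
  then show "norm ((sup p (\<delta> *\<^sub>R 1) - e) $ i) \<le> norm ((p - e) $ i)"
    by (simp add: sup_vec_def sup_max)
qed

text \<open>The whole ball lies in the open half-space of negative inner products, so
  \<open>d\<close> is at distance more than \<open>r\<close> from \<open>e\<close> along the unit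
  step direction. Expanding the square gives the gain.\<close>

lemma psg_step_descent:
  fixes M :: "real ^ 'n ^ 'n"
  assumes M: "symmetric_posdef M" and step: "psg_step M \<delta> t d d'" and t: "0 < t"
    and d: "\<And>i. 0 < d $ i" and e: "e \<in> Omega \<delta>" and r: "0 \<le> r"
    and ball: "\<And>y. y \<in> cball e r \<Longrightarrow> (\<forall>i. 0 < y $ i) \<and> cond_ratio M y < cond_ratio M d"
  shows "(norm (d' - e))\<^sup>2 \<le> (norm (d - e))\<^sup>2 - 2 * t * r + t\<^sup>2"
proof -
  obtain u v s where uv: "eigenpair (M ** Diag d) (lambda_max (M ** Diag d)) u"
      "eigenpair (M ** Diag d) (lambda_min (M ** Diag d)) v"
    and s: "s = subgrad d (lambda_max (M ** Diag d)) u (lambda_min (M ** Diag d)) v"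
    and d': "d' = sup (d - t *\<^sub>R ((1 / norm s) *\<^sub>R s)) (\<delta> *\<^sub>R 1)"
    using step unfolding psg_step_def by metis
  have neg: "s \<bullet> (y - d) < 0" if "y \<in> cball e r" for y
    unfolding s using ball[OF that] uv by (intro subgrad_descent[OF M d]) auto
  \<comment> \<open>Strict descent towards the centre excludes \<open>s = 0\<close>, so the default
    value of \<open>1 / 0\<close> does not arise.\<close>
  then have s0: "s \<noteq> 0" using neg[of e] r by (metis centre_in_cball inner_zero_left less_irrefl)
  define n where "n = (1 / norm s) *\<^sub>R s"
  have n: "norm n = 1" "n \<bullet> s = norm s"
    using s0 by (simp_all add: n_def norm_eq_sqrt_inner real_div_sqrt)
  \<comment> \<open>The point of the ball farthest in the direction of \<open>s\<close>.\<close>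
  have "s \<bullet> ((e + r *\<^sub>R n) - d) < 0"
    using n(1) r by (intro neg) (simp add: dist_norm)
  then have "s \<bullet> (e - d) + r * norm s < 0"
    using n(2) by (simp add: inner_diff_right inner_add_right inner_commute)
  then have "(s \<bullet> (e - d) + r * norm s) / norm s < 0"
    using s0 by (simp add: divide_neg_pos)
  then have "n \<bullet> (e - d) + r < 0" using s0 by (simp add: n_def field_simps)
  then have "t * (n \<bullet> (e - d) + r) \<le> 0" using t by (simp add: mult_le_0_iff)
  then have *: "t * r \<le> t * (n \<bullet> (d - e))"
    by (simp add: inner_diff_right algebra_simps)
  have "(norm (d' - e))\<^sup>2 \<le> (norm ((d - t *\<^sub>R n) - e))\<^sup>2"
    unfolding d' n_def by (intro power_mono norm_sup_diff_le e) simp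
  also have "(d - t *\<^sub>R n) - e = (d - e) - t *\<^sub>R n" by simp
  also have "(norm ((d - e) - t *\<^sub>R n))\<^sup>2 = (norm (d - e))\<^sup>2 - 2 * (t * (n \<bullet> (d - e))) + t\<^sup>2"
    using n(1) dot_norm_neg[of "d - e" "t *\<^sub>R n"] by (simp add: inner_commute field_simps)
  also have "\<dots> \<le> (norm (d - e))\<^sup>2 - 2 * t * r + t\<^sup>2" using * by simp
  finally show ?thesis .
qed

section \<open>The iterates and their values\<close>

lemma psg_iterate_in_Omega:
  assumes "psg_run M t \<delta> tol stopcrit d" "\<delta> < 1" "1 \<le> k"
  shows "d k \<in> Omega \<delta>"
proof (cases "k = 1")
  case True
  with assms show ?thesis by (auto simp: psg_run_def mem_Omega)
next
  case False
  with \<open>1 \<le> k\<close> obtain j where j: "k = Suc j" "1 \<le> j" by (cases k) auto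
  then have "psg_step M \<delta> (t j) (d j) (d (Suc j))" using assms(1) by (simp add: psg_run_def)
  then show ?thesis unfolding j(1) Omega_def by (auto simp: psg_step_def simp del: scaleR_one)
qed

text \<open>Continuity yields a ball around \<open>e\<close> on which the ratio stays below
  \<open>L\<close>. If the iterates were eventually at or above \<open>L\<close>,
  \<open>psg_step_descent\<close> would apply to all late steps with this ball.\<close>

lemma psg_frequently_below:
  fixes M :: "real ^ 'n ^ 'n"
  assumes M: "symmetric_posdef M" and \<delta>: "0 < \<delta>" "\<delta> < 1"
    and t: "\<And>k. k \<ge> 1 \<Longrightarrow> 0 < t k" "t \<longlonglongrightarrow> 0"
    and sum: "filterlim (\<lambda>m. \<Sum>k=1..m. t k) at_top sequentially"
    and run: "psg_run M t \<delta> tol stopcrit d"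
    and e: "e \<in> Omega \<delta>" "cond_ratio M e < L"
  shows "\<exists>\<^sub>F k in sequentially. cond_ratio M (d k) < L"
proof (rule ccontr)
  assume "\<not> ?thesis"
  then have "\<forall>\<^sub>F k in sequentially. L \<le> cond_ratio M (d k)"
    by (simp add: not_frequently not_less)
  let ?P = "{d :: real ^ 'n. \<forall>i. 0 < d $ i}"
  have "?P = (\<Inter>i. {d. 0 < d $ i})" by auto
  also have "open \<dots>" by (intro open_INT ballI open_Collect_less continuous_intros) auto
  finally have "open (?P \<inter> cond_ratio M -` {..<L})"
    by (intro continuous_open_preimage continuous_on_cond_ratio M) auto
  moreover have "e \<in> ?P \<inter> cond_ratio M -` {..<L}"
    using e \<delta> by (auto simp: mem_Omega intro: less_le_trans)
  ultimately obtain r where r: "0 < r" "cball e r \<subseteq> ?P \<inter> cond_ratio M -` {..<L}"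
    by (meson open_contains_cball)
  have "\<forall>\<^sub>F k in sequentially. t k < r" using t(2) r(1) by (rule order_tendstoD)
  with \<open>\<forall>\<^sub>F k in sequentially. L \<le> cond_ratio M (d k)\<close>
  have "\<forall>\<^sub>F k in sequentially. t k < r \<and> L \<le> cond_ratio M (d k)" by eventually_elim simp
  then obtain N where N: "\<And>k. k \<ge> N \<Longrightarrow> t k < r \<and> L \<le> cond_ratio M (d k)"
    by (auto simp: eventually_sequentially)
  \<comment> \<open>A potential: once \<open>t k < r\<close>, the gain
    \<open>2 * t k * r - (t k)\<^sup>2\<close> is at least \<open>r * t k\<close>, so
    \<open>g\<close> no longer increases. The index \<open>Suc m\<close> matches the sum, as
    \<open>d (Suc m)\<close> results from steps 1 to \<open>m\<close>.\<close>
  define g where "g m = (norm (d (Suc m) - e))\<^sup>2 + r * (\<Sum>k=1..m. t k)" for m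
  have step: "g (Suc m) \<le> g m" if "N \<le> m" for m
  proof -
    let ?k = "Suc m"
    have tk: "0 < t ?k" "t ?k < r" and L: "L \<le> cond_ratio M (d ?k)" using t(1) N that by auto
    have dpos: "0 < d ?k $ i" for i
      using psg_iterate_in_Omega[OF run \<delta>(2), of ?k] \<delta>(1) by (auto simp: mem_Omega intro: less_le_trans)
    have "(norm (d (Suc ?k) - e))\<^sup>2 \<le> (norm (d ?k - e))\<^sup>2 - 2 * t ?k * r + (t ?k)\<^sup>2"
    proof (rule psg_step_descent[OF M _ tk(1) dpos e(1)])
      show "psg_step M \<delta> (t ?k) (d ?k) (d (Suc ?k))" using run by (simp add: psg_run_def)
    qed (use r L in auto)
    moreover have "(t ?k)\<^sup>2 \<le> t ?k * r" using tk by (simp add: power2_eq_square)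
    ultimately show ?thesis by (simp add: g_def distrib_left mult_ac)
  qed
  have "g m \<le> g N" if "N \<le> m" for m
    using that by (induction m rule: dec_induct) (auto intro: order_trans[OF step])
  moreover have "r * (\<Sum>k=1..m. t k) \<le> g m" for m by (simp add: g_def)
  ultimately have "r * (\<Sum>k=1..m. t k) \<le> g N" if "N \<le> m" for m
    using that order_trans by blast
  then have bdd: "(\<Sum>k=1..m. t k) \<le> g N / r" if "N \<le> m" for m
    using that r(1) by (simp add: field_simps)
  have "\<forall>\<^sub>F m in sequentially. g N / r < (\<Sum>k=1..m. t k)"
    using sum by (simp add: filterlim_at_top_dense)
  then have "\<forall>\<^sub>F m in sequentially. False"
    using eventually_ge_at_top[of N] by eventually_elim (use bdd in fastforce)
  then show False by simp
qed

theorem theorem2p13: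
  fixes M :: "real ^ 'n ^ 'n" and \<delta> tol :: real and t :: "nat \<Rightarrow> real"
    and stopcrit :: "nat \<Rightarrow> ereal" and d :: "nat \<Rightarrow> real ^ 'n"
  assumes "symmetric_posdef M"
    and "0 < \<delta>" and "\<delta> < 1"
    and "\<And>k. k \<ge> 1 \<Longrightarrow> 0 < t k"
    and "t \<longlonglongrightarrow> 0"
    and "filterlim (\<lambda>m. \<Sum>k=1..m. t k) at_top sequentially"
    and "psg_run M t \<delta> tol stopcrit d"
  shows "kappa_star M \<delta> \<in> kappa M \<delta> ` Omega \<delta> \<and>
    liminf (\<lambda>k. kappa M \<delta> (d k)) = kappa_star M \<delta> \<and>
    antimono_on {1..} (kappa_best M \<delta> d) \<and>
    kappa_best M \<delta> d \<longlonglongrightarrow> kappa_star M \<delta>"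
proof -
  obtain e where e: "e \<in> Omega \<delta>" "\<And>d. d \<in> Omega \<delta> \<Longrightarrow> cond_ratio M e \<le> cond_ratio M d"
    using cond_ratio_attains_min[OF assms(1-3)] by metis
  have kappa: "kappa M \<delta> d = ereal (cond_ratio M d)" if "d \<in> Omega \<delta>" for d
    using that by (simp add: kappa_def cond_ratio_def)
  have star: "kappa_star M \<delta> = ereal (cond_ratio M e)"
    unfolding kappa_star_def
  proof (rule antisym)
    show "(INF d\<in>Omega \<delta>. kappa M \<delta> d) \<le> ereal (cond_ratio M e)"
      by (rule INF_lower2[OF e(1)]) (simp add: kappa[OF e(1)])
    show "ereal (cond_ratio M e) \<le> (INF d\<in>Omega \<delta>. kappa M \<delta> d)"
      by (rule INF_greatest) (simp add: kappa e(2))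
  qed
  \<comment> \<open>Outside \<open>Omega\<close> the value is infinite, so the bound covers every
    vector, including \<open>d 0\<close>, which the run leaves unconstrained.\<close>
  have ge: "kappa_star M \<delta> \<le> kappa M \<delta> x" for x :: "real ^ 'n"
    by (cases "x \<in> Omega \<delta>") (simp_all add: star kappa e(2), simp add: kappa_def)
  have freq: "\<exists>\<^sub>F k in sequentially. kappa M \<delta> (d k) < a" if a: "kappa_star M \<delta> < a" for a
  proof -
    \<comment> \<open>Since \<open>a\<close> may be infinite, a real threshold is inserted below
      it.\<close>
    obtain L where L: "cond_ratio M e < L" "ereal L < a"
      using a ereal_dense2[of "ereal (cond_ratio M e)" a] by (auto simp: star)
    have "\<exists>\<^sub>F k in sequentially. cond_ratio M (d k) < L"
      by (rule psg_frequently_below[OF assms e(1) L(1)])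
    then have "\<exists>\<^sub>F k in sequentially. cond_ratio M (d k) < L \<and> 1 \<le> k"
      by (rule frequently_eventually_frequently) (rule eventually_ge_at_top)
    then show ?thesis
    proof (rule frequently_elim1)
      fix k assume k: "cond_ratio M (d k) < L \<and> 1 \<le> k"
      then have "d k \<in> Omega \<delta>" by (intro psg_iterate_in_Omega[OF assms(7,3)]) simp
      with k have "kappa M \<delta> (d k) < ereal L" by (simp add: kappa)
      with L(2) show "kappa M \<delta> (d k) < a" by (rule less_trans[rotated])
    qed
  qed
  have "kappa_star M \<delta> \<in> kappa M \<delta> ` Omega \<delta>"
    using e(1) by (simp add: star flip: kappa)
  moreover have "liminf (\<lambda>k. kappa M \<delta> (d k)) = kappa_star M \<delta>"
  proof (rule antisym)
    show "kappa_star M \<delta> \<le> liminf (\<lambda>k. kappa M \<delta> (d k))"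
      by (intro Liminf_bounded always_eventually allI ge)
    show "liminf (\<lambda>k. kappa M \<delta> (d k)) \<le> kappa_star M \<delta>"
    proof (rule ccontr)
      assume "\<not> ?thesis"
      \<comment> \<open>Such a level would be exceeded by all late values and yet undercut
        infinitely often.\<close>
      then obtain a where a: "kappa_star M \<delta> < a" "a < liminf (\<lambda>k. kappa M \<delta> (d k))"
        using dense not_le by metis
      have "\<exists>\<^sub>F k in sequentially. kappa M \<delta> (d k) < a" by (rule freq[OF a(1)])
      then have "\<exists>\<^sub>F k in sequentially. False"
        by (rule frequently_rev_mp) (use less_LiminfD[OF a(2)] in \<open>eventually_elim, auto\<close>)
      then show False by simp
    qed
  qed
  moreover have "antimono_on {1..} (kappa_best M \<delta> d)"
    unfolding kappa_best_def by (auto intro!: monotone_onI Min_antimono)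
  moreover have "kappa_best M \<delta> d \<longlonglongrightarrow> kappa_star M \<delta>"
  proof (rule order_tendstoI)
    fix a assume a: "a < kappa_star M \<delta>"
    show "\<forall>\<^sub>F k in sequentially. a < kappa_best M \<delta> d k"
      \<comment> \<open>From index 1 on, the minimum is over a nonempty set.\<close>
      using eventually_ge_at_top[of 1]
    proof eventually_elim
      case (elim k)
      then show ?case unfolding kappa_best_def
        by (subst Min_gr_iff) (auto intro: less_le_trans[OF a ge])
    qed
  next
    fix a assume a: "kappa_star M \<delta> < a"
    \<comment> \<open>One good iterate suffices, because it takes part in every later running
      minimum.\<close>
    obtain j where j: "1 \<le> j" "kappa M \<delta> (d j) < a"
      using freq[OF a] by (auto simp: frequently_sequentially)
    show "\<forall>\<^sub>F k in sequentially. kappa_best M \<delta> d k < a"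
      using eventually_ge_at_top[of j]
    proof eventually_elim
      case (elim k)
      with j have "kappa_best M \<delta> d k \<le> kappa M \<delta> (d j)"
        unfolding kappa_best_def by (intro Min_le) auto
      with j(2) show ?case by simp
    qed
  qed
  ultimately show ?thesis by blast
qed

end
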